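(* Let $G$ be a finite simple graph with no isolated vertices that is not isomorphic to any of the following graphs: (1) the cycle $C_6$; (2) the cycle $C_6$ with vertices $x_0,\dots,x_5$ in cyclic order together with the chord $x_0x_2$; (3) the cycle $C_6$ with vertices $x_0,\dots,x_5$ in cyclic order together with the chords $x_0x_2$ and $x_3x_5$; (4) the graph with vertex set $\{r,s,t,u,v,w,x\}$ and edge set $\{rs,tu,rv,uv,rw,tw,sx,tx,ux\}$; (5) for any integers $a,b,c\ge 0$: the graph with vertices $r,s,t,u$ and edges $rs,tu$, together with pairwise disjoint sets $W,X,Y$ of sizes $a,b,c$ such that $W\cup X\cup Y$ is independent, every vertex of $W$ is adjacent exactly to $s,t,u$, every vertex of $X$ exactly to $r,t,u$, and every vertex of $Y$ exactly to $r,s,t,u$; (6) for any integers $a,b,c,d\ge 0$: the graph with vertices $r,s,t,u$ and edges $rs,tu$, together with pairwise disjoint sets $W,X,Y,Z$ of sizes $a,b,c,d$ such that $W\cup X\cup Y\cup Z$ is independent, every vertex of $W$ is adjacent exactly to $s,t$, every vertex of $X$ exactly to $s,u$, every vertex of $Y$ exactly to $s,t,u$, and every vertex of $Z$ exactly to $r,s,t,u$. Then $G$ is $2K_2$-free if and only if $G/e$ is $2K_2$-free for every edge $e\in E(G)$.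
   Context: All graphs are finite and simple. $2K_2$ is the graph consisting of two disjoint edges (four vertices). A graph is $H$-free if it has no induced subgraph isomorphic to $H$. For an edge $e=uv$ of $G$, the contraction $G/e$ is obtained from $G$ by deleting $u$ and $v$ and adding a new vertex adjacent to every vertex of $(N(u)\cup N(v))\setminus\{u,v\}$. *)

theory Defs
  imports Main
begin

record 'a graph =
  verts :: "'a set"
  edges :: "'a set set"

definition finite_simple_graph :: "'a graph \<Rightarrow> bool" where
  "finite_simple_graph G \<longleftrightarrow>
     finite (verts G) \<and> (\<forall>e\<in>edges G. e \<subseteq> verts G \<and> card e = 2)"

definition neighbors :: "'a graph \<Rightarrow> 'a \<Rightarrow> 'a set" where
  "neighbors G v = {w. {v, w} \<in> edges G}"

definition isolated :: "'a graph \<Rightarrow> 'a \<Rightarrow> bool" where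
  "isolated G v \<longleftrightarrow> v \<in> verts G \<and> neighbors G v = {}"

definition graph_iso :: "'a graph \<Rightarrow> 'b graph \<Rightarrow> bool" where
  "graph_iso G H \<longleftrightarrow>
     (\<exists>f. bij_betw f (verts G) (verts H) \<and>
          (\<forall>u\<in>verts G. \<forall>v\<in>verts G. {u, v} \<in> edges G \<longleftrightarrow> {f u, f v} \<in> edges H))"

definition induced_subgraph :: "'a graph \<Rightarrow> 'a set \<Rightarrow> 'a graph" where
  "induced_subgraph G S = \<lparr>verts = S, edges = {e \<in> edges G. e \<subseteq> S}\<rparr>"

definition graph_free :: "'b graph \<Rightarrow> 'a graph \<Rightarrow> bool" where
  "graph_free H G \<longleftrightarrow> \<not> (\<exists>S \<subseteq> verts G. graph_iso (induced_subgraph G S) H)"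

definition two_K2 :: "nat graph" where
  "two_K2 = \<lparr>verts = {0, 1, 2, 3}, edges = {{0, 1}, {2, 3}}\<rparr>"

text \<open>In the contraction, \<open>None\<close> is the new vertex and \<open>Some x\<close> is the surviving vertex \<open>x\<close>.
  For \<open>e = {u, v}\<close> the union below is \<open>N(u) \<union> N(v)\<close>.\<close>

definition contract :: "'a graph \<Rightarrow> 'a set \<Rightarrow> 'a option graph" where
  "contract G e =
     \<lparr>verts = insert None (Some ` (verts G - e)),
      edges = {{Some x, Some y} | x y. {x, y} \<in> edges G \<and> x \<notin> e \<and> y \<notin> e}
            \<union> {{None, Some x} | x. x \<in> (\<Union>w\<in>e. neighbors G w) - e}\<rparr>"

definition C6_plus :: "nat set set \<Rightarrow> nat graph" where
  "C6_plus chords =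
     \<lparr>verts = {0, 1, 2, 3, 4, 5},
      edges = {{0, 1}, {1, 2}, {2, 3}, {3, 4}, {4, 5}, {5, 0}} \<union> chords\<rparr>"

datatype seven = r7 | s7 | t7 | u7 | v7 | w7 | x7

definition seven_graph :: "seven graph" where
  "seven_graph =
     \<lparr>verts = {r7, s7, t7, u7, v7, w7, x7},
      edges = {{r7, s7}, {t7, u7}, {r7, v7}, {u7, v7}, {r7, w7}, {t7, w7},
               {s7, x7}, {t7, x7}, {u7, x7}}\<rparr>"

text \<open>Vertices of the two infinite families: the sets \<open>W, X, Y, Z\<close> consist of the
  vertices \<open>Wv i, Xv i, Yv i, Zv i\<close> with \<open>i\<close> below the prescribed size.\<close>

datatype fam_vertex = Rv | Sv | Tv | Uv | Wv nat | Xv nat | Yv nat | Zv nat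

definition family3 :: "nat \<Rightarrow> nat \<Rightarrow> nat \<Rightarrow> fam_vertex graph" where
  "family3 a b c =
     \<lparr>verts = {Rv, Sv, Tv, Uv} \<union> Wv ` {..<a} \<union> Xv ` {..<b} \<union> Yv ` {..<c},
      edges = {{Rv, Sv}, {Tv, Uv}}
            \<union> {{Wv i, p} | i p. i < a \<and> p \<in> {Sv, Tv, Uv}}
            \<union> {{Xv i, p} | i p. i < b \<and> p \<in> {Rv, Tv, Uv}}
            \<union> {{Yv i, p} | i p. i < c \<and> p \<in> {Rv, Sv, Tv, Uv}}\<rparr>"

definition family4 :: "nat \<Rightarrow> nat \<Rightarrow> nat \<Rightarrow> nat \<Rightarrow> fam_vertex graph" where
  "family4 a b c d =
     \<lparr>verts = {Rv, Sv, Tv, Uv} \<union> Wv ` {..<a} \<union> Xv ` {..<b} \<union> Yv ` {..<c} \<union> Zv ` {..<d},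
      edges = {{Rv, Sv}, {Tv, Uv}}
            \<union> {{Wv i, p} | i p. i < a \<and> p \<in> {Sv, Tv}}
            \<union> {{Xv i, p} | i p. i < b \<and> p \<in> {Sv, Uv}}
            \<union> {{Yv i, p} | i p. i < c \<and> p \<in> {Sv, Tv, Uv}}
            \<union> {{Zv i, p} | i p. i < d \<and> p \<in> {Rv, Sv, Tv, Uv}}\<rparr>"

end

theory Submission
  imports Defs
begin

text \<open>Being \<open>2K\<^sub>2\<close>-free is inherited by contractions. Conversely, let \<open>rs\<close>, \<open>tu\<close> induce a
  \<open>2K\<^sub>2\<close> in \<open>G\<close> while every contraction is \<open>2K\<^sub>2\<close>-free. Contracting an edge that misses \<open>r, s, t, u\<close>
  would keep this \<open>2K\<^sub>2\<close>, so the remaining vertices are independent, and contracting \<open>xr\<close>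
  shows that each remaining vertex \<open>x\<close> has a neighbour on both edges. If \<open>y\<close> is adjacent to \<open>s\<close> but not
  \<open>t\<close>, and \<open>z\<close> to \<open>t\<close> but not \<open>s\<close>, then \<open>sy\<close>, \<open>tz\<close> is another induced \<open>2K\<^sub>2\<close>, so all other
  remaining vertices are adjacent to exactly \<open>s, t\<close>; this leads to the sporadic graphs. If there are no such
  pairs for any choice of ends of the two edges, then the sets of non-neighbours of \<open>r, s, t, u\<close> are nested
  across the two edges, which leads to the two families.\<close>

section \<open>Induced \<open>2K_2\<close> as a relation on four vertices\<close>

definition induced_2K2 :: "'a graph \<Rightarrow> 'a \<Rightarrow> 'a \<Rightarrow> 'a \<Rightarrow> 'a \<Rightarrow> bool" where
  "induced_2K2 G a b c d \<longleftrightarrow> {a, b} \<in> edges G \<and> {c, d} \<in> edges G \<and>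
     {a, c} \<notin> edges G \<and> {a, d} \<notin> edges G \<and> {b, c} \<notin> edges G \<and> {b, d} \<notin> edges G"

lemma induced_2K2_swap:
  "induced_2K2 G a b c d \<Longrightarrow> induced_2K2 G b a c d"
  "induced_2K2 G a b c d \<Longrightarrow> induced_2K2 G c d a b"
  by (auto simp: induced_2K2_def insert_commute)

lemma simple_edgeD:
  assumes "finite_simple_graph G" "{a, b} \<in> edges G"
  shows "a \<in> verts G" "b \<in> verts G" "a \<noteq> b"
  using assms by (auto simp: finite_simple_graph_def)

lemma simple_edgeE:
  assumes "finite_simple_graph G" "e \<in> edges G"
  obtains a b where "e = {a, b}"
  using assms by (auto simp: finite_simple_graph_def card_2_iff)

text \<open>Distinctness comes for free in a simple graph: if, say, \<open>a = c\<close>, then the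
  edge \<open>{a, b}\<close> would be the forbidden pair \<open>{b, c}\<close>.\<close>

lemma induced_2K2_distinct:
  assumes "finite_simple_graph G" "induced_2K2 G a b c d"
  shows "distinct [a, b, c, d]"
  using assms simple_edgeD(3)[OF assms(1)] by (auto simp: induced_2K2_def insert_commute)

lemma induced_2K2_edge:
  assumes G: "finite_simple_graph G" and ind: "induced_2K2 G a b c d"
    and edge: "{x, y} \<in> edges G" and xy: "x \<in> {a, b, c, d}" "y \<in> {a, b, c, d}"
  shows "{x, y} \<in> {{a, b}, {c, d}}"
proof -
  have "{y, x} \<in> edges G" using edge by (simp add: insert_commute)
  moreover have "x \<noteq> y" using simple_edgeD(3)[OF G edge] .
  ultimately show ?thesis using edge xy ind unfolding induced_2K2_def
    by (elim insertE emptyE) (simp_all add: doubleton_eq_iff)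
qed

text \<open>The target graphs have fixed vertex names, so an explicit labelling \<open>g\<close> is
  most naturally given from \<open>H\<close> to \<open>G\<close>; its inverse is the isomorphism
  that \<open>graph_iso\<close> asks for.\<close>

lemma graph_iso_sym_intro:
  assumes bij: "bij_betw g (verts H) (verts G)"
    and simple: "\<forall>e\<in>edges H. e \<subseteq> verts H"
    and edges: "edges G = (`) g ` edges H"
  shows "graph_iso G H"
proof -
  let ?f = "inv_into (verts H) g"
  have f: "bij_betw ?f (verts G) (verts H)" by (rule bij_betw_inv_into[OF bij])
  have "{u, v} \<in> edges G \<longleftrightarrow> {?f u, ?f v} \<in> edges H" if "u \<in> verts G" "v \<in> verts G" for u v
  proof -
    have in_H: "?f u \<in> verts H" "?f v \<in> verts H" using f that by (auto simp: bij_betw_def)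
    have im: "g ` {?f u, ?f v} = {u, v}"
      using that bij by (simp add: bij_betw_inv_into_right)
    \<comment> \<open>Edges of \<open>H\<close> lie inside \<open>verts H\<close>, where
      \<open>g\<close> is injective, so an edge is determined by its image.\<close>
    have "g ` e = g ` {?f u, ?f v} \<longleftrightarrow> e = {?f u, ?f v}" if "e \<in> edges H" for e
      using inj_on_image_eq_iff[of g "verts H" e "{?f u, ?f v}"] bij simple that in_H
      by (auto simp: bij_betw_def)
    then show ?thesis unfolding edges im[symmetric] by auto
  qed
  with f show ?thesis unfolding graph_iso_def by blast
qed

lemma graph_free_two_K2_iff:
  assumes G: "finite_simple_graph G"
  shows "graph_free two_K2 G \<longleftrightarrow> \<not> (\<exists>a b c d. induced_2K2 G a b c d)"
proof -
  have "\<exists>a b c d. induced_2K2 G a b c d"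
    if S: "S \<subseteq> verts G" and iso: "graph_iso (induced_subgraph G S) two_K2" for S
  proof -
    from iso obtain f where bij: "bij_betw f (verts (induced_subgraph G S)) (verts two_K2)"
      and iso_f: "\<forall>u\<in>verts (induced_subgraph G S). \<forall>v\<in>verts (induced_subgraph G S).
        {u, v} \<in> edges (induced_subgraph G S) \<longleftrightarrow> {f u, f v} \<in> edges two_K2"
      unfolding graph_iso_def by (elim exE conjE)
    have f: "{u, v} \<in> edges G \<longleftrightarrow> {f u, f v} \<in> {{0, 1}, {2, 3}}" if "u \<in> S" "v \<in> S" for u v
      using iso_f that by (simp add: induced_subgraph_def two_K2_def)
    have "f ` S = {0, 1, 2, 3}"
      using bij by (simp add: bij_betw_def induced_subgraph_def two_K2_def)
    then have "0 \<in> f ` S" "1 \<in> f ` S" "2 \<in> f ` S" "3 \<in> f ` S" by simp_all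
    then obtain a b c d where "a \<in> S" "b \<in> S" "c \<in> S" "d \<in> S"
      "0 = f a" "1 = f b" "2 = f c" "3 = f d" by (elim imageE)
    note this(1-4) this(5-8)[symmetric]
    then have "induced_2K2 G a b c d"
      unfolding induced_2K2_def by (simp add: f doubleton_eq_iff)
    then show ?thesis by blast
  qed
  moreover have "\<exists>S\<subseteq>verts G. graph_iso (induced_subgraph G S) two_K2"
    if ind: "induced_2K2 G a b c d" for a b c d
  proof -
    let ?g = "\<lambda>n. [a, b, c, d] ! n"
    have d: "distinct [a, b, c, d]" by (rule induced_2K2_distinct[OF G ind])
    have sub: "{a, b, c, d} \<subseteq> verts G"
      using ind simple_edgeD[OF G] by (auto simp: induced_2K2_def)
    have E: "{e \<in> edges G. e \<subseteq> {a, b, c, d}} = {{a, b}, {c, d}}"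
    proof (rule subset_antisym)
      show "{{a, b}, {c, d}} \<subseteq> {e \<in> edges G. e \<subseteq> {a, b, c, d}}"
        using ind unfolding induced_2K2_def by blast
      show "{e \<in> edges G. e \<subseteq> {a, b, c, d}} \<subseteq> {{a, b}, {c, d}}"
      proof
        fix e assume e: "e \<in> {e \<in> edges G. e \<subseteq> {a, b, c, d}}"
        then obtain x y where xy: "e = {x, y}" using simple_edgeE[OF G] by blast
        then show "e \<in> {{a, b}, {c, d}}"
          using induced_2K2_edge[OF G ind, of x y] e by auto
      qed
    qed
    have "graph_iso (induced_subgraph G {a, b, c, d}) two_K2"
    proof (rule graph_iso_sym_intro[where g = ?g])
      have "inj_on ?g {0, 1, 2, 3}" using d by (auto simp: inj_on_def)
      then show "bij_betw ?g (verts two_K2) (verts (induced_subgraph G {a, b, c, d}))"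
        by (simp add: bij_betw_def two_K2_def induced_subgraph_def)
      show "\<forall>e\<in>edges two_K2. e \<subseteq> verts two_K2" by (simp add: two_K2_def)
      show "edges (induced_subgraph G {a, b, c, d}) = (`) ?g ` edges two_K2"
        by (simp add: induced_subgraph_def two_K2_def E)
    qed
    with sub show ?thesis by blast
  qed
  ultimately have "(\<exists>S\<subseteq>verts G. graph_iso (induced_subgraph G S) two_K2) \<longleftrightarrow>
      (\<exists>a b c d. induced_2K2 G a b c d)"
    by (intro iffI) (elim exE conjE, assumption+)+
  then show ?thesis unfolding graph_free_def by simp
qed

section \<open>Induced \<open>2K_2\<close> in a contraction versus in the graph itself\<close>

lemma contract_edge_iff [simp]:
  "{Some x, Some y} \<in> edges (contract G e) \<longleftrightarrow> {x, y} \<in> edges G \<and> x \<notin> e \<and> y \<notin> e"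
  "{None, Some x} \<in> edges (contract G e) \<longleftrightarrow> x \<notin> e \<and> (\<exists>w\<in>e. {w, x} \<in> edges G)"
  "{Some x, None} \<in> edges (contract G e) \<longleftrightarrow> x \<notin> e \<and> (\<exists>w\<in>e. {w, x} \<in> edges G)"
  by (auto simp: contract_def neighbors_def doubleton_eq_iff insert_commute)

lemma finite_simple_graph_contract:
  assumes "finite_simple_graph G"
  shows "finite_simple_graph (contract G e)"
proof -
  have "finite (verts (contract G e))"
    using assms by (simp add: contract_def finite_simple_graph_def)
  moreover have "f \<subseteq> verts (contract G e) \<and> card f = 2" if "f \<in> edges (contract G e)" for f
    using that simple_edgeD[OF assms] by (fastforce simp: contract_def neighbors_def)
  ultimately show ?thesis by (simp add: finite_simple_graph_def)
qed

text \<open>If \<open>None\<close> occurs, replace it by an element \<open>w\<close> of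
  \<open>e\<close> adjacent to its partner. The non-neighbours of \<open>None\<close> among the
  surviving vertices are adjacent to no element of \<open>e\<close>, so the non-edges
  persist.\<close>

lemma induced_2K2_of_contract:
  assumes "finite_simple_graph G" "induced_2K2 (contract G e) a b c d"
  shows "\<exists>a b c d. induced_2K2 G a b c d"
proof -
  \<comment> \<open>The pair \<open>{None, None}\<close> is not covered by
    \<open>contract_edge_iff\<close>; simplicity of the contraction excludes it.\<close>
  have nloop: "{None} \<notin> edges (contract G e)"
    using simple_edgeD(3)[OF finite_simple_graph_contract[OF assms(1)], of None None] by auto
  have None: "\<exists>a b c d. induced_2K2 G a b c d"
    if "induced_2K2 (contract G e) None b c d" for b c d
  proof -
    from that nloop induced_2K2_distinct[OF finite_simple_graph_contract[OF assms(1)] that]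
    obtain x y z where [simp]: "b = Some x" "c = Some y" "d = Some z"
      by (cases b; cases c; cases d) auto
    from that obtain w where "w \<in> e" "{w, x} \<in> edges G" by (auto simp: induced_2K2_def)
    with that have "induced_2K2 G w x y z" by (auto simp: induced_2K2_def)
    then show ?thesis by blast
  qed
  show ?thesis
  proof (cases "None \<in> {a, b, c, d}")
    case True
    then consider "a = None" | "b = None" | "c = None" | "d = None" by auto
    then show ?thesis
      using None assms(2) induced_2K2_swap(1)[OF assms(2)] induced_2K2_swap(2)[OF assms(2)]
        induced_2K2_swap(1)[OF induced_2K2_swap(2)[OF assms(2)]]
      by cases metis+
  next
    case False
    then obtain a' b' c' d' where "a = Some a'" "b = Some b'" "c = Some c'" "d = Some d'"
      by (cases a; cases b; cases c; cases d) auto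
    with assms(2) have "induced_2K2 G a' b' c' d'" by (auto simp: induced_2K2_def)
    then show ?thesis by blast
  qed
qed

text \<open>Source of the locale assumption \<open>meets\<close>: a \<open>2K_2\<close> that
  \<open>e\<close> misses survives the contraction.\<close>

lemma contract_disjoint_edge:
  assumes "induced_2K2 G a b c d" "e \<inter> {a, b, c, d} = {}"
  shows "induced_2K2 (contract G e) (Some a) (Some b) (Some c) (Some d)"
  using assms by (auto simp: induced_2K2_def)

text \<open>Source of the locale assumption \<open>attached\<close>: the merged vertex takes over
  the role of \<open>a\<close>, since neither \<open>x\<close> nor \<open>a\<close> is adjacent to
  \<open>c\<close> or \<open>d\<close>.\<close>

lemma contract_pendant_edge:
  assumes "finite_simple_graph G" "induced_2K2 G a b c d" "x \<noteq> b"
    and "{x, c} \<notin> edges G" "{x, d} \<notin> edges G" "x \<noteq> c" "x \<noteq> d"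
  shows "induced_2K2 (contract G {x, a}) None (Some b) (Some c) (Some d)"
  using assms induced_2K2_distinct[OF assms(1,2)] by (auto simp: induced_2K2_def)

section \<open>A graph containing a \<open>2K_2\<close> that no contraction preserves\<close>

locale critical_2K2 =
  fixes G :: "'a graph" and r s t u :: 'a
  assumes simple: "finite_simple_graph G"
    and no_isolated: "\<not> isolated G v"
    and base: "induced_2K2 G r s t u"
    and meets: "induced_2K2 G a b c d \<Longrightarrow> e \<in> edges G \<Longrightarrow> e \<inter> {a, b, c, d} \<noteq> {}"
    and attached: "induced_2K2 G a b c d \<Longrightarrow> {x, a} \<in> edges G \<Longrightarrow> x \<noteq> b \<Longrightarrow>
           {x, c} \<in> edges G \<or> {x, d} \<in> edges G"
begin

text \<open>The assumptions \<open>meets\<close> and \<open>attached\<close> speak of every induced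
  \<open>2K_2\<close>, not only of the base, so they are unaffected by reordering the base. These
  three swaps generate all symmetries of \<open>2K_2\<close>, and later cases are reduced to one
  another by interpreting the locale at a reordered base.\<close>

lemma swap_first: "critical_2K2 G s r t u"
  and swap_second: "critical_2K2 G r s u t"
  and swap_pairs: "critical_2K2 G t u r s"
  using critical_2K2_axioms induced_2K2_swap(1)[OF base] induced_2K2_swap(2)[OF base]
    induced_2K2_swap(2)[OF induced_2K2_swap(1)[OF induced_2K2_swap(2)[OF base]]]
  by (simp_all add: critical_2K2_def)

definition rest :: "'a set" where
  "rest = verts G - {r, s, t, u}"

abbreviation N :: "'a \<Rightarrow> 'a set" where "N \<equiv> neighbors G"

lemma finite_rest: "finite rest"
  using simple by (simp add: finite_simple_graph_def rest_def)

lemma distinct_base: "distinct [r, s, t, u]"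
  by (rule induced_2K2_distinct[OF simple base])

lemma verts_eq: "verts G = {r, s, t, u} \<union> rest"
  using base simple_edgeD[OF simple] by (auto simp: rest_def induced_2K2_def)

lemma neighbors_rest: "x \<in> rest \<Longrightarrow> N x \<subseteq> {r, s, t, u}"
  using meets[OF base] by (fastforce simp: rest_def neighbors_def)

lemma neighbors_attached_first:
  assumes "x \<in> rest" "N x \<inter> {r, s} \<noteq> {}"
  shows "N x \<inter> {t, u} \<noteq> {}"
  using assms attached[OF base, of x] attached[OF induced_2K2_swap(1)[OF base], of x]
  by (auto simp: neighbors_def rest_def)

end

lemma (in critical_2K2) rest_swap:
  "critical_2K2.rest G s r t u = rest"
  "critical_2K2.rest G r s u t = rest"
  "critical_2K2.rest G t u r s = rest"
  using critical_2K2.rest_def[OF swap_first] critical_2K2.rest_def[OF swap_second]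
    critical_2K2.rest_def[OF swap_pairs]
  by (auto simp: rest_def)

context critical_2K2
begin

text \<open>A vertex of \<open>rest\<close> is not isolated and all its neighbours lie in the base,
  so it meets one base edge; \<open>attached\<close> then forces a neighbour on the other.\<close>

lemma neighbors_both:
  assumes "x \<in> rest"
  shows "N x \<inter> {r, s} \<noteq> {}" "N x \<inter> {t, u} \<noteq> {}"
proof -
  have "N x \<noteq> {}" using no_isolated[of x] assms by (auto simp: isolated_def rest_def)
  then show "N x \<inter> {r, s} \<noteq> {}" "N x \<inter> {t, u} \<noteq> {}"
    using neighbors_rest[OF assms] neighbors_attached_first[OF assms]
      critical_2K2.neighbors_attached_first[OF swap_pairs, of x] assms rest_swap(3)
    by auto
qed

text \<open>Since \<open>rest\<close> is independent, \<open>G\<close> is determined by the base and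
  the sets \<open>N x\<close>. All isomorphisms below are read off from this description.\<close>

lemma edges_eq:
  "edges G = {{r, s}, {t, u}} \<union> {{x, p} |x p. x \<in> rest \<and> p \<in> N x}"
proof (intro set_eqI iffI)
  fix e assume e: "e \<in> edges G"
  then obtain x y where xy: "e = {x, y}" using simple_edgeE[OF simple] by blast
  show "e \<in> {{r, s}, {t, u}} \<union> {{x, p} |x p. x \<in> rest \<and> p \<in> N x}"
  proof (cases "x \<in> rest \<or> y \<in> rest")
    case True
    moreover have "e = {y, x}" "y \<in> N x" "x \<in> N y"
      using e xy by (simp_all add: neighbors_def insert_commute)
    ultimately show ?thesis using xy by blast
  next
    case False
    then have "x \<in> {r, s, t, u}" "y \<in> {r, s, t, u}"
      using simple_edgeD[OF simple] e xy verts_eq by blast+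
    then show ?thesis using induced_2K2_edge[OF simple base] e xy by blast
  qed
next
  fix e assume "e \<in> {{r, s}, {t, u}} \<union> {{x, p} |x p. x \<in> rest \<and> p \<in> N x}"
  then show "e \<in> edges G" using base unfolding induced_2K2_def neighbors_def by blast
qed

section \<open>Crossing pairs and the sporadic graphs\<close>

definition crossing :: "'a \<Rightarrow> 'a \<Rightarrow> 'a \<Rightarrow> 'a \<Rightarrow> bool" where
  "crossing p q y z \<longleftrightarrow> y \<in> rest \<and> z \<in> rest \<and> p \<in> N y \<and> q \<notin> N y \<and> q \<in> N z \<and> p \<notin> N z"

lemma crossing_swap:
  "critical_2K2.crossing G s r t u = crossing"
  "critical_2K2.crossing G r s u t = crossing"
  "critical_2K2.crossing G t u r s = crossing"
  using critical_2K2.crossing_def[OF swap_first] critical_2K2.crossing_def[OF swap_second]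
    critical_2K2.crossing_def[OF swap_pairs]
  by (auto simp: crossing_def rest_swap fun_eq_iff)

text \<open>The edges \<open>sy\<close> and \<open>tz\<close> form a second induced
  \<open>2K_2\<close>, which every edge must meet. Hence neither \<open>xr\<close> nor
  \<open>xu\<close> is an edge, and only \<open>s\<close> and \<open>t\<close> are left as
  neighbours of \<open>x\<close>, one on each base edge.\<close>

lemma crossing_others:
  assumes "crossing s t y z" "x \<in> rest" "x \<noteq> y" "x \<noteq> z"
  shows "N x = {s, t}"
proof -
  have yz: "{y, z} \<notin> edges G"
    using assms(1) neighbors_rest by (auto simp: crossing_def neighbors_def rest_def)
  have "induced_2K2 G s y t z"
    using assms(1) base yz by (auto simp: crossing_def induced_2K2_def neighbors_def insert_commute)
  note m = meets[OF this]
  have "y \<in> rest" "z \<in> rest" using assms(1) by (auto simp: crossing_def)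
  then have "r \<notin> N x" "u \<notin> N x"
    using m[of "{x, r}"] m[of "{x, u}"] assms(2-) distinct_base
    by (auto simp: neighbors_def rest_def)
  then show ?thesis using neighbors_rest[OF assms(2)] neighbors_both[OF assms(2)] by auto
qed

lemma crossing_others_rt:
  "crossing r t y z \<Longrightarrow> x \<in> rest \<Longrightarrow> x \<noteq> y \<Longrightarrow> x \<noteq> z \<Longrightarrow> N x = {r, t}"
  using critical_2K2.crossing_others[OF swap_first] by (simp add: rest_swap crossing_swap)

lemma crossing_others_su:
  "crossing s u y z \<Longrightarrow> x \<in> rest \<Longrightarrow> x \<noteq> y \<Longrightarrow> x \<noteq> z \<Longrightarrow> N x = {s, u}"
  using critical_2K2.crossing_others[OF swap_second] by (simp add: rest_swap crossing_swap)

lemma crossing_others_ru: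
  assumes "crossing r u y z" "x \<in> rest" "x \<noteq> y" "x \<noteq> z"
  shows "N x = {r, u}"
proof -
  interpret S: critical_2K2 G s r t u by (rule swap_first)
  show ?thesis using S.crossing_others_su assms by (simp add: rest_swap crossing_swap)
qed

lemma seven_iso:
  assumes rest: "rest = {x, y, z}" and nb: "N x = {s, t}" "N y = {r, s, u}" "N z = {r, t}"
  shows "graph_iso G seven_graph"
proof (rule graph_iso_sym_intro)
  \<comment> \<open>The base edges change places: \<open>x7\<close> is adjacent to both
    \<open>t7\<close> and \<open>u7\<close>, while \<open>y\<close> is adjacent to both
    \<open>r\<close> and \<open>s\<close>, so \<open>t7 u7\<close> goes to \<open>rs\<close> and
    \<open>r7 s7\<close> to \<open>tu\<close>.\<close>
  let ?g = "\<lambda>n. case n of r7 \<Rightarrow> t | s7 \<Rightarrow> u | t7 \<Rightarrow> r | u7 \<Rightarrow> s | v7 \<Rightarrow> x | w7 \<Rightarrow> z | x7 \<Rightarrow> y"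
  have ne: "x \<noteq> y" "x \<noteq> z" "y \<noteq> z"
    using nb distinct_base by auto
  have new: "x \<notin> {r, s, t, u}" "y \<notin> {r, s, t, u}" "z \<notin> {r, s, t, u}"
    using rest by (auto simp: rest_def)
  have d: "distinct [r, s, t, u, x, y, z]"
    using distinct_base ne new by auto
  show "bij_betw ?g (verts seven_graph) (verts G)"
    using d unfolding verts_eq rest by (auto simp: seven_graph_def bij_betw_def)
  show "\<forall>e\<in>edges seven_graph. e \<subseteq> verts seven_graph"
    by (auto simp: seven_graph_def)
  have "{{a, p} |a p. a \<in> rest \<and> p \<in> N a} =
      (\<lambda>p. {x, p}) ` N x \<union> (\<lambda>p. {y, p}) ` N y \<union> (\<lambda>p. {z, p}) ` N z"
    unfolding rest by blast
  then have "edges G =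
      {{r, s}, {t, u}, {x, s}, {x, t}, {y, r}, {y, s}, {y, u}, {z, r}, {z, t}}"
    unfolding edges_eq nb by (simp only: image_insert image_empty Un_insert_left Un_empty_left)
  moreover have "(`) ?g ` edges seven_graph =
      {{t, u}, {r, s}, {t, x}, {s, x}, {t, z}, {r, z}, {u, y}, {r, y}, {s, y}}"
    by (simp add: seven_graph_def)
  ultimately show "edges G = (`) ?g ` edges seven_graph"
    by (simp only:) (intro subset_antisym; simp add: doubleton_eq_iff)
qed

lemma C6_iso:
  assumes rest: "rest = {y, z}"
    and nb: "N y = {s, u} \<or> N y = {r, s, u}" "N z = {r, t} \<or> N z = {r, t, u}"
  shows "graph_iso G (C6_plus {}) \<or> graph_iso G (C6_plus {{0, 2}}) \<or>
    graph_iso G (C6_plus {{0, 2}, {3, 5}})"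
proof -
  have ne: "y \<noteq> z" using nb distinct_base by auto
  have d: "distinct [r, s, t, u, y, z]"
    using distinct_base ne rest by (auto simp: rest_def)
  have E: "{{a, p} |a p. a \<in> rest \<and> p \<in> N a} = (\<lambda>p. {y, p}) ` N y \<union> (\<lambda>p. {z, p}) ` N z"
    unfolding rest by auto
  have iso: "graph_iso G (C6_plus C)"
    if "distinct (map g [0, 1, 2, 3, 4, 5])" "set (map g [0, 1, 2, 3, 4, 5]) = {r, s, t, u, y, z}"
      and "\<forall>e\<in>C. e \<subseteq> {0, 1, 2, 3, 4, 5}"
      and "(`) g ` edges (C6_plus C) \<subseteq> {{r, s}, {t, u}} \<union> ((\<lambda>p. {y, p}) ` N y \<union> (\<lambda>p. {z, p}) ` N z)"
      and "{{r, s}, {t, u}} \<union> ((\<lambda>p. {y, p}) ` N y \<union> (\<lambda>p. {z, p}) ` N z) \<subseteq> (`) g ` edges (C6_plus C)"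
    for g C
  proof (rule graph_iso_sym_intro[where g = g])
    show "bij_betw g (verts (C6_plus C)) (verts G)"
      using that(1,2) by (auto simp: bij_betw_def C6_plus_def verts_eq rest)
    show "\<forall>e\<in>edges (C6_plus C). e \<subseteq> verts (C6_plus C)"
      using that(3) by (auto simp: C6_plus_def)
    show "edges G = (`) g ` edges (C6_plus C)"
      unfolding edges_eq E using that(4,5) by (intro subset_antisym)
  qed
  \<comment> \<open>Both lists run around the hexagon \<open>y s r z t u\<close>. The possible
    chords are \<open>yr\<close> and \<open>zu\<close>: starting at \<open>y\<close> they sit at
    positions 0, 2 and 3, 5. Starting at \<open>z\<close> puts \<open>zu\<close> at 0, 2, as needed
    when it is the only chord.\<close>
  let ?y = "\<lambda>n. [y, s, r, z, t, u] ! n"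
  let ?z = "\<lambda>n. [z, t, u, y, s, r] ! n"
  from nb consider
      "N y = {s, u}" "N z = {r, t}" | "N y = {r, s, u}" "N z = {r, t}"
    | "N y = {s, u}" "N z = {r, t, u}" | "N y = {r, s, u}" "N z = {r, t, u}" by blast
  then show ?thesis
  proof cases
    case 1
    then have "graph_iso G (C6_plus {})" using d
      by (intro iso[of ?y]) (auto simp: C6_plus_def doubleton_eq_iff)
    then show ?thesis by blast
  next
    case 2
    then have "graph_iso G (C6_plus {{0, 2}})" using d
      by (intro iso[of ?y]) (auto simp: C6_plus_def doubleton_eq_iff)
    then show ?thesis by blast
  next
    case 3
    then have "graph_iso G (C6_plus {{0, 2}})" using d
      by (intro iso[of ?z]) (auto simp: C6_plus_def doubleton_eq_iff)
    then show ?thesis by blast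
  next
    case 4
    then have "graph_iso G (C6_plus {{0, 2}, {3, 5}})" using d
      by (intro iso[of ?y]) (auto simp: C6_plus_def doubleton_eq_iff)
    then show ?thesis by blast
  qed
qed

text \<open>The crossing fixes \<open>N y\<close> up to \<open>r\<close> and \<open>N z\<close> up
  to \<open>u\<close>. Without further vertices this is a hexagon with chords; with a further vertex
  \<open>x\<close>, new crossings that involve \<open>x\<close> or the other pair of ends pin down
  everything else.\<close>

lemma crossing_sporadic:
  assumes cr: "crossing s t y z"
  shows "graph_iso G (C6_plus {}) \<or> graph_iso G (C6_plus {{0, 2}}) \<or>
    graph_iso G (C6_plus {{0, 2}, {3, 5}}) \<or> graph_iso G seven_graph"
proof -
  have yz: "y \<in> rest" "z \<in> rest" "s \<in> N y" "t \<notin> N y" "t \<in> N z" "s \<notin> N z"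
    using cr by (auto simp: crossing_def)
  have y: "N y = {s, u} \<or> N y = {r, s, u}"
    using yz neighbors_both[of y] neighbors_rest[of y] by auto
  have z: "N z = {r, t} \<or> N z = {r, t, u}"
    using yz neighbors_both[of z] neighbors_rest[of z] by auto
  show ?thesis
  proof (cases "rest = {y, z}")
    case True
    then show ?thesis using C6_iso y z by blast
  next
    case False
    then obtain x where x: "x \<in> rest" "x \<noteq> y" "x \<noteq> z" using yz by auto
    have Nx: "N x = {s, t}" by (rule crossing_others[OF cr x])
    have d: "r \<noteq> s" "r \<noteq> t" "r \<noteq> u" "s \<noteq> t" "s \<noteq> u" "t \<noteq> u" using distinct_base by auto
    \<comment> \<open>A fourth vertex \<open>w\<close> would also have \<open>N w = {s, t}\<close>.
      The extra neighbour of \<open>y\<close> or of \<open>z\<close> creates a crossing with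
      \<open>x\<close> at another pair of ends, which forces a different value of
      \<open>N w\<close>.\<close>
    have only: "w = x \<or> w = y \<or> w = z"
      if "w \<in> rest" "N y = {r, s, u} \<or> N z = {r, t, u}" for w
    proof (rule ccontr)
      assume w: "\<not> ?thesis"
      then have Nw: "N w = {s, t}" using crossing_others[OF cr that(1)] by simp
      from that(2) show False
      proof
        assume "N y = {r, s, u}"
        then have "crossing r t y x" using Nx x yz d by (auto simp: crossing_def)
        from crossing_others_rt[OF this that(1)] have "N w = {r, t}" using w by simp
        then show False using Nw d by (simp add: doubleton_eq_iff)
      next
        assume "N z = {r, t, u}"
        then have "crossing s u x z" using Nx x yz d by (auto simp: crossing_def)
        from crossing_others_su[OF this that(1)] have "N w = {s, u}" using w by simp
        then show False using Nw d by (simp add: doubleton_eq_iff)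
      qed
    qed
    consider "N y = {s, u}" "N z = {r, t}" | "N y = {r, s, u}" | "N y = {s, u}" "N z = {r, t, u}"
      using y z by blast
    then show ?thesis
    proof cases
      case 1
      \<comment> \<open>Here \<open>y\<close> and \<open>z\<close> also cross at the opposite ends
        \<open>r\<close> and \<open>u\<close>, which dictates \<open>N x = {r, u}\<close>, against
        \<open>N x = {s, t}\<close>.\<close>
      then have "crossing r u z y" using yz d by (auto simp: crossing_def)
      from crossing_others_ru[OF this x(1)] have "N x = {r, u}" using x by simp
      then show ?thesis using Nx d by (simp add: doubleton_eq_iff)
    next
      case 2
      then have "crossing r t y x" using Nx x yz d by (auto simp: crossing_def)
      \<comment> \<open>The new crossing between \<open>y\<close> and \<open>x\<close> is applied to
        \<open>z\<close>; it also rules out that \<open>y\<close> and \<open>z\<close> both have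
        three neighbours.\<close>
      from crossing_others_rt[OF this yz(2)] have "N z = {r, t}" using yz x by auto
      moreover have "rest = {x, y, z}" using only 2 x yz by blast
      ultimately show ?thesis using seven_iso 2 Nx by blast
    next
      case 3
      \<comment> \<open>This is the mirror image of the previous case: exchange \<open>r\<close>
        with \<open>u\<close>, \<open>s\<close> with \<open>t\<close>, and \<open>y\<close> with
        \<open>z\<close>.\<close>
      interpret T: critical_2K2 G t u r s by (rule swap_pairs)
      interpret U: critical_2K2 G u t r s by (rule T.swap_first)
      interpret V: critical_2K2 G u t s r by (rule U.swap_second)
      have "rest = {x, z, y}" using only 3 x yz by blast
      then have "V.rest = {x, z, y}" by (simp add: V.rest_def rest_def insert_commute)
      moreover have "N x = {t, s}" "N z = {u, t, r}" "N y = {u, s}"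
        using Nx 3 by (simp_all add: insert_commute)
      ultimately have "graph_iso G seven_graph" by (rule V.seven_iso)
      then show ?thesis by blast
    qed
  qed
qed

end

section \<open>Nested sets and vertex enumerations for the two families\<close>

lemma nested_pairs:
  fixes A B C D :: "'a set"
  assumes disj: "A \<inter> B = {}" "C \<inter> D = {}"
    and nest: "A \<subseteq> C \<or> C \<subseteq> A" "A \<subseteq> D \<or> D \<subseteq> A" "B \<subseteq> C \<or> C \<subseteq> B" "B \<subseteq> D \<or> D \<subseteq> B"
  shows "C = {} \<and> D = {} \<or> A = {} \<and> B = {} \<or>
    B = {} \<and> C \<subseteq> A \<and> D \<subseteq> A \<or> A = {} \<and> C \<subseteq> B \<and> D \<subseteq> B \<or>
    D = {} \<and> A \<subseteq> C \<and> B \<subseteq> C \<or> C = {} \<and> A \<subseteq> D \<and> B \<subseteq> D"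
proof -
  have AB: "X = {}" if "X \<subseteq> A" "X \<subseteq> B" for X using disj(1) that by blast
  have CD: "X = {}" if "X \<subseteq> C" "X \<subseteq> D" for X using disj(2) that by blast
  \<comment> \<open>A set comparable with both of two disjoint sets is empty, contains both, or lies
    in one of them while the other is empty.\<close>
  have C: "C = {} \<or> A \<subseteq> C \<and> B \<subseteq> C \<or> B = {} \<and> C \<subseteq> A \<or> A = {} \<and> C \<subseteq> B"
    using nest(1,3) AB[of A] AB[of B] AB[of C] by (elim disjE) auto
  have D: "D = {} \<or> A \<subseteq> D \<and> B \<subseteq> D \<or> B = {} \<and> D \<subseteq> A \<or> A = {} \<and> D \<subseteq> B"
    using nest(2,4) AB[of A] AB[of B] AB[of D] by (elim disjE) auto
  show ?thesis
  proof (cases "C = {} \<or> D = {}")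
    case True
    then show ?thesis using C D by auto
  next
    case False
    \<comment> \<open>Disjoint nonempty sets are incomparable. This eliminates the mixed
      combinations of \<open>C\<close> and \<open>D\<close> in which one set would be nested in the
      other or empty.\<close>
    then have "\<not> C \<subseteq> D" "\<not> D \<subseteq> C" using CD by auto
    with False C D show ?thesis using CD[of A] CD[of B] order_trans by metis
  qed
qed

lemma image_spokes:
  assumes "(\<lambda>i. g (F i)) ` {..<n} = S"
  shows "(`) g ` {{F i, p} |i p. i < n \<and> p \<in> P} = {{x, p} |x p. x \<in> S \<and> p \<in> g ` P}"
proof -
  have "{{F i, p} |i p. i < n \<and> p \<in> P} = (\<lambda>(i, p). {F i, p}) ` ({..<n} \<times> P)" by auto
  then have "(`) g ` {{F i, p} |i p. i < n \<and> p \<in> P} = (\<lambda>(i, p). {g (F i), g p}) ` ({..<n} \<times> P)"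
    by (simp add: image_image case_prod_unfold)
  also have "\<dots> = {{x, p} |x p. x \<in> (\<lambda>i. g (F i)) ` {..<n} \<and> p \<in> g ` P}"
    by auto
  finally show ?thesis unfolding assms .
qed

text \<open>One labelling serves both families: for \<open>family3\<close> the class
  \<open>Z\<close> is taken empty.\<close>

lemma family_enumeration:
  assumes fin: "finite W" "finite X" "finite Y" "finite Z"
    and d: "distinct [r, s, t, u]"
    and new: "(W \<union> X \<union> Y \<union> Z) \<inter> {r, s, t, u} = {}"
    and disj: "W \<inter> X = {}" "W \<inter> Y = {}" "W \<inter> Z = {}" "X \<inter> Y = {}" "X \<inter> Z = {}" "Y \<inter> Z = {}"
  obtains g where "g Rv = r" "g Sv = s" "g Tv = t" "g Uv = u"
    "(\<lambda>i. g (Wv i)) ` {..<card W} = W" "(\<lambda>i. g (Xv i)) ` {..<card X} = X"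
    "(\<lambda>i. g (Yv i)) ` {..<card Y} = Y" "(\<lambda>i. g (Zv i)) ` {..<card Z} = Z"
    "inj_on g ({Rv, Sv, Tv, Uv} \<union> Wv ` {..<card W} \<union> Xv ` {..<card X} \<union> Yv ` {..<card Y}
       \<union> Zv ` {..<card Z})"
proof -
  have ex: "\<exists>h. inj_on h {..<card A} \<and> h ` {..<card A} = A" if "finite A" for A :: "'a set"
    using ex_bij_betw_nat_finite[OF that] by (auto simp: bij_betw_def atLeast0LessThan)
  obtain w where w: "inj_on w {..<card W}" "w ` {..<card W} = W" using ex fin(1) by blast
  obtain x where x: "inj_on x {..<card X}" "x ` {..<card X} = X" using ex fin(2) by blast
  obtain y where y: "inj_on y {..<card Y}" "y ` {..<card Y} = Y" using ex fin(3) by blast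
  obtain z where z: "inj_on z {..<card Z}" "z ` {..<card Z} = Z" using ex fin(4) by blast
  have mem: "i < card W \<Longrightarrow> w i \<in> W" "i < card X \<Longrightarrow> x i \<in> X"
      "i < card Y \<Longrightarrow> y i \<in> Y" "i < card Z \<Longrightarrow> z i \<in> Z" for i
    using w(2) x(2) y(2) z(2) by auto
  define g where "g v = (case v of Rv \<Rightarrow> r | Sv \<Rightarrow> s | Tv \<Rightarrow> t | Uv \<Rightarrow> u
    | Wv i \<Rightarrow> w i | Xv i \<Rightarrow> x i | Yv i \<Rightarrow> y i | Zv i \<Rightarrow> z i)" for v
  \<comment> \<open>\<open>tag\<close> recovers the label of a vertex and so is a left inverse of
    \<open>g\<close> on the labels in use. Proving injectivity this way needs one case per kind of
    label instead of one per pair of kinds.\<close>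
  define tag where "tag p = (if p = r then Rv else if p = s then Sv else if p = t then Tv
    else if p = u then Uv else if p \<in> W then Wv (inv_into {..<card W} w p)
    else if p \<in> X then Xv (inv_into {..<card X} x p)
    else if p \<in> Y then Yv (inv_into {..<card Y} y p)
    else Zv (inv_into {..<card Z} z p))" for p
  show thesis
  proof (rule that[of g])
    show "inj_on g ({Rv, Sv, Tv, Uv} \<union> Wv ` {..<card W} \<union> Xv ` {..<card X} \<union> Yv ` {..<card Y}
       \<union> Zv ` {..<card Z})"
    proof (rule inj_on_inverseI[where g = tag])
      fix v assume "v \<in> {Rv, Sv, Tv, Uv} \<union> Wv ` {..<card W} \<union> Xv ` {..<card X}
        \<union> Yv ` {..<card Y} \<union> Zv ` {..<card Z}"
      then consider "v = Rv" | "v = Sv" | "v = Tv" | "v = Uv"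
        | i where "v = Wv i" "i < card W" | i where "v = Xv i" "i < card X"
        | i where "v = Yv i" "i < card Y" | i where "v = Zv i" "i < card Z" by blast
      then show "tag (g v) = v"
      proof cases
        case (5 i)
        then show ?thesis using d new disj mem(1)[of i] w(1) by (auto simp: tag_def g_def)
      next
        case (6 i)
        then show ?thesis using d new disj mem(2)[of i] x(1) by (auto simp: tag_def g_def)
      next
        case (7 i)
        then show ?thesis using d new disj mem(3)[of i] y(1) by (auto simp: tag_def g_def)
      next
        case (8 i)
        then show ?thesis using d new disj mem(4)[of i] z(1) by (auto simp: tag_def g_def)
      qed (use d in \<open>auto simp: tag_def g_def\<close>)
    qed
  qed (use w x y z in \<open>auto simp: g_def\<close>)
qed

section \<open>Isomorphisms onto the two families\<close>

context critical_2K2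
begin

definition typed :: "'a set \<Rightarrow> 'a set" where
  "typed S = {x \<in> rest. N x = S}"

lemma typed_disjoint: "(p \<in> S) \<noteq> (p \<in> S') \<Longrightarrow> typed S \<inter> typed S' = {}"
  by (auto simp: typed_def)

lemma spokes_Un:
  "{{x, p} |x p. x \<in> A \<union> B \<and> p \<in> N x} =
    {{x, p} |x p. x \<in> A \<and> p \<in> N x} \<union> {{x, p} |x p. x \<in> B \<and> p \<in> N x}"
  by blast

text \<open>On a class of vertices with equal neighbourhoods \<open>N x\<close> becomes a constant,
  which gives the edges of \<open>G\<close> the block form used by the families.\<close>

lemma spokes_typed:
  "{{x, p} |x p. x \<in> typed S \<and> p \<in> N x} = {{x, p} |x p. x \<in> typed S \<and> p \<in> S}"
proof -
  have "x \<in> typed S \<and> p \<in> N x \<longleftrightarrow> x \<in> typed S \<and> p \<in> S" for x p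
    by (auto simp: typed_def)
  then show ?thesis by (simp only:)
qed

text \<open>Each neighbourhood contains \<open>t\<close> and \<open>u\<close> and a nonempty part of
  \<open>{r, s}\<close>, which leaves the three classes of the family.\<close>

lemma family3_iso:
  assumes full: "\<And>x. x \<in> rest \<Longrightarrow> t \<in> N x \<and> u \<in> N x"
  shows "\<exists>a b c. graph_iso G (family3 a b c)"
proof -
  let ?W = "typed {s, t, u}" and ?X = "typed {r, t, u}" and ?Y = "typed {r, s, t, u}"
  have d: "r \<noteq> s" "r \<noteq> t" "r \<noteq> u" "s \<noteq> t" "s \<noteq> u" "t \<noteq> u" using distinct_base by auto
  have rest: "rest = ?W \<union> ?X \<union> ?Y"
  proof (intro set_eqI iffI)
    fix x assume x: "x \<in> rest"
    have "N x = {s, t, u} \<or> N x = {r, t, u} \<or> N x = {r, s, t, u}"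
      using full[OF x] neighbors_rest[OF x] neighbors_both[OF x] by blast
    with x show "x \<in> ?W \<union> ?X \<union> ?Y" by (auto simp: typed_def)
  qed (auto simp: typed_def)
  have fin: "finite ?W" "finite ?X" "finite ?Y" "finite ({} :: 'a set)"
    using finite_rest by (auto simp: typed_def)
  have new: "(?W \<union> ?X \<union> ?Y \<union> {}) \<inter> {r, s, t, u} = {}"
    by (auto simp: typed_def rest_def)
  have disj: "?W \<inter> ?X = {}" "?W \<inter> ?Y = {}" "?W \<inter> {} = {}" "?X \<inter> ?Y = {}" "?X \<inter> {} = {}"
    "?Y \<inter> {} = {}"
    using d by (simp_all add: typed_disjoint[of r] typed_disjoint[of s])
  obtain g where g: "g Rv = r" "g Sv = s" "g Tv = t" "g Uv = u"
    "(\<lambda>i. g (Wv i)) ` {..<card ?W} = ?W" "(\<lambda>i. g (Xv i)) ` {..<card ?X} = ?X"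
    "(\<lambda>i. g (Yv i)) ` {..<card ?Y} = ?Y"
    and inj: "inj_on g ({Rv, Sv, Tv, Uv} \<union> Wv ` {..<card ?W} \<union> Xv ` {..<card ?X} \<union> Yv ` {..<card ?Y}
       \<union> Zv ` {..<card ({} :: 'a set)})"
    by (rule family_enumeration[OF fin distinct_base new disj])
  let ?H = "family3 (card ?W) (card ?X) (card ?Y)"
  have "graph_iso G ?H"
  proof (rule graph_iso_sym_intro)
    have "g ` verts ?H = verts G"
      using g unfolding verts_eq rest family3_def by (simp add: image_Un image_image Un_ac)
    then show "bij_betw g (verts ?H) (verts G)"
      using inj by (simp add: bij_betw_def family3_def)
    show "\<forall>e\<in>edges ?H. e \<subseteq> verts ?H" by (auto simp: family3_def)
    \<comment> \<open>The first \<open>unfolding\<close> rewrites the image of \<open>?H\<close>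
      block by block, the second brings \<open>edges G\<close> into the same blocks; only the
      bracketing of the unions differs.\<close>
    show "edges G = (`) g ` edges ?H"
      unfolding family3_def graph.select_convs image_Un image_spokes[of g Wv, OF g(5)] image_spokes[of g Xv, OF g(6)]
        image_spokes[of g Yv, OF g(7)]
      unfolding edges_eq rest spokes_Un spokes_typed image_insert image_empty g(1-4)
      by (simp only: Un_assoc)
  qed
  then show ?thesis by blast
qed

text \<open>Each neighbourhood contains \<open>s\<close> and a nonempty part of
  \<open>{t, u}\<close>, and \<open>r\<close> can be added only when that part is all of
  \<open>{t, u}\<close>; this leaves four classes.\<close>

lemma family4_iso:
  assumes s: "\<And>x. x \<in> rest \<Longrightarrow> s \<in> N x"
    and r: "\<And>x. x \<in> rest \<Longrightarrow> r \<in> N x \<Longrightarrow> t \<in> N x \<and> u \<in> N x"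
  shows "\<exists>a b c d. graph_iso G (family4 a b c d)"
proof -
  let ?W = "typed {s, t}" and ?X = "typed {s, u}" and ?Y = "typed {s, t, u}"
    and ?Z = "typed {r, s, t, u}"
  have d: "r \<noteq> s" "r \<noteq> t" "r \<noteq> u" "s \<noteq> t" "s \<noteq> u" "t \<noteq> u" using distinct_base by auto
  have rest: "rest = ?W \<union> ?X \<union> ?Y \<union> ?Z"
  proof (intro set_eqI iffI)
    fix x assume x: "x \<in> rest"
    have "N x = {s, t} \<or> N x = {s, u} \<or> N x = {s, t, u} \<or> N x = {r, s, t, u}"
      using s[OF x] r[OF x] neighbors_rest[OF x] neighbors_both[OF x] by blast
    with x show "x \<in> ?W \<union> ?X \<union> ?Y \<union> ?Z" by (auto simp: typed_def)
  qed (auto simp: typed_def)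
  have fin: "finite ?W" "finite ?X" "finite ?Y" "finite ?Z"
    using finite_rest by (auto simp: typed_def)
  have new: "(?W \<union> ?X \<union> ?Y \<union> ?Z) \<inter> {r, s, t, u} = {}"
    by (auto simp: typed_def rest_def)
  have disj: "?W \<inter> ?X = {}" "?W \<inter> ?Y = {}" "?W \<inter> ?Z = {}" "?X \<inter> ?Y = {}" "?X \<inter> ?Z = {}"
    "?Y \<inter> ?Z = {}"
    using d by (simp_all add: typed_disjoint[of r] typed_disjoint[of t] typed_disjoint[of u])
  obtain g where g: "g Rv = r" "g Sv = s" "g Tv = t" "g Uv = u"
    "(\<lambda>i. g (Wv i)) ` {..<card ?W} = ?W" "(\<lambda>i. g (Xv i)) ` {..<card ?X} = ?X"
    "(\<lambda>i. g (Yv i)) ` {..<card ?Y} = ?Y" "(\<lambda>i. g (Zv i)) ` {..<card ?Z} = ?Z"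
    and inj: "inj_on g ({Rv, Sv, Tv, Uv} \<union> Wv ` {..<card ?W} \<union> Xv ` {..<card ?X} \<union> Yv ` {..<card ?Y}
       \<union> Zv ` {..<card ?Z})"
    by (rule family_enumeration[OF fin distinct_base new disj])
  let ?H = "family4 (card ?W) (card ?X) (card ?Y) (card ?Z)"
  have "graph_iso G ?H"
  proof (rule graph_iso_sym_intro)
    have "g ` verts ?H = verts G"
      using g unfolding verts_eq rest family4_def by (simp add: image_Un image_image Un_ac)
    then show "bij_betw g (verts ?H) (verts G)"
      using inj by (simp add: bij_betw_def family4_def)
    show "\<forall>e\<in>edges ?H. e \<subseteq> verts ?H" by (auto simp: family4_def)
    show "edges G = (`) g ` edges ?H"
      unfolding family4_def graph.select_convs image_Un image_spokes[of g Wv, OF g(5)] image_spokes[of g Xv, OF g(6)]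
        image_spokes[of g Yv, OF g(7)] image_spokes[of g Zv, OF g(8)]
      unfolding edges_eq rest spokes_Un spokes_typed image_insert image_empty g(1-4)
      by (simp only: Un_assoc)
  qed
  then show ?thesis by blast
qed

lemma no_crossing_family:
  assumes nc: "\<And>p q y z. p \<in> {r, s} \<Longrightarrow> q \<in> {t, u} \<Longrightarrow> \<not> crossing p q y z"
  shows "(\<exists>a b c. graph_iso G (family3 a b c)) \<or> (\<exists>a b c d. graph_iso G (family4 a b c d))"
proof -
  define M where "M p = {x \<in> rest. p \<notin> N x}" for p
  \<comment> \<open>If both inclusions failed, a witness from each difference would give a crossing
    at \<open>p\<close> and \<open>q\<close>.\<close>
  have nest: "M p \<subseteq> M q \<or> M q \<subseteq> M p" if "p \<in> {r, s}" "q \<in> {t, u}" for p q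
    using nc[OF that] by (auto simp: M_def crossing_def)
  have disj: "M r \<inter> M s = {}" "M t \<inter> M u = {}"
    using neighbors_both by (auto simp: M_def)
  interpret S: critical_2K2 G s r t u by (rule swap_first)
  interpret T: critical_2K2 G t u r s by (rule swap_pairs)
  interpret U: critical_2K2 G u t r s by (rule T.swap_first)
  have rests: "S.rest = rest" "T.rest = rest" "U.rest = rest"
    by (simp_all add: S.rest_def T.rest_def U.rest_def rest_def insert_commute)
  have "M t = {} \<and> M u = {} \<or> M r = {} \<and> M s = {} \<or>
      M s = {} \<and> M t \<subseteq> M r \<and> M u \<subseteq> M r \<or> M r = {} \<and> M t \<subseteq> M s \<and> M u \<subseteq> M s \<or>
      M u = {} \<and> M r \<subseteq> M t \<and> M s \<subseteq> M t \<or> M t = {} \<and> M r \<subseteq> M u \<and> M s \<subseteq> M u"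
    using nested_pairs[OF disj nest[of r t] nest[of r u] nest[of s t] nest[of s u]] by simp
  \<comment> \<open>Two empty sets on one base edge give \<open>family3\<close>. Otherwise the end
    with empty \<open>M\<close> plays the role of \<open>s\<close>, and its partner, whose
    non-neighbours include those of both ends of the other base edge, plays the role of
    \<open>r\<close>.\<close>
  then show ?thesis
  proof (elim disjE conjE)
    assume "M t = {}" "M u = {}"
    then show ?thesis using family3_iso by (auto simp: M_def)
  next
    assume "M r = {}" "M s = {}"
    then show ?thesis using T.family3_iso by (auto simp: M_def rests)
  next
    assume "M s = {}" "M t \<subseteq> M r" "M u \<subseteq> M r"
    then show ?thesis by (intro disjI2 family4_iso) (auto simp: M_def)
  next
    assume "M r = {}" "M t \<subseteq> M s" "M u \<subseteq> M s"
    then show ?thesis by (intro disjI2 S.family4_iso) (auto simp: M_def rests)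
  next
    assume "M u = {}" "M r \<subseteq> M t" "M s \<subseteq> M t"
    then show ?thesis by (intro disjI2 T.family4_iso) (auto simp: M_def rests)
  next
    assume "M t = {}" "M r \<subseteq> M u" "M s \<subseteq> M u"
    then show ?thesis by (intro disjI2 U.family4_iso) (auto simp: M_def rests)
  qed
qed

section \<open>The classification and its use for the equivalence\<close>

lemma classification:
  "graph_iso G (C6_plus {}) \<or> graph_iso G (C6_plus {{0, 2}}) \<or>
    graph_iso G (C6_plus {{0, 2}, {3, 5}}) \<or> graph_iso G seven_graph \<or>
    (\<exists>a b c. graph_iso G (family3 a b c)) \<or> (\<exists>a b c d. graph_iso G (family4 a b c d))"
proof (cases "\<exists>p\<in>{r, s}. \<exists>q\<in>{t, u}. \<exists>y z. crossing p q y z")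
  case True
  \<comment> \<open>The reorderings move a crossing at any of the four pairs of ends to the pair
    \<open>s\<close>, \<open>t\<close> treated in \<open>crossing_sporadic\<close>; the relation
    \<open>crossing\<close> itself does not change.\<close>
  interpret S: critical_2K2 G s r t u by (rule swap_first)
  interpret U: critical_2K2 G r s u t by (rule swap_second)
  interpret SU: critical_2K2 G s r u t by (rule S.swap_second)
  have "S.crossing = crossing" "U.crossing = crossing" "SU.crossing = crossing"
    using crossing_swap S.crossing_swap by simp_all
  with True have "graph_iso G (C6_plus {}) \<or> graph_iso G (C6_plus {{0, 2}}) \<or>
    graph_iso G (C6_plus {{0, 2}, {3, 5}}) \<or> graph_iso G seven_graph"
    using crossing_sporadic S.crossing_sporadic U.crossing_sporadic SU.crossing_sporadic
    by (metis insertE singletonD)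
  then show ?thesis by blast
next
  case False
  then show ?thesis using no_crossing_family by blast
qed

end

theorem theorem25:
  fixes G :: "'a graph"
  assumes "finite_simple_graph G"
    and "\<not> (\<exists>v. isolated G v)"
    and "\<not> graph_iso G (C6_plus {})"
    and "\<not> graph_iso G (C6_plus {{0, 2}})"
    and "\<not> graph_iso G (C6_plus {{0, 2}, {3, 5}})"
    and "\<not> graph_iso G seven_graph"
    and "\<And>a b c. \<not> graph_iso G (family3 a b c)"
    and "\<And>a b c d. \<not> graph_iso G (family4 a b c d)"
  shows "graph_free two_K2 G \<longleftrightarrow> (\<forall>e\<in>edges G. graph_free two_K2 (contract G e))"
proof
  assume "graph_free two_K2 G"
  then have "\<not> (\<exists>a b c d. induced_2K2 G a b c d)"
    using graph_free_two_K2_iff[OF assms(1)] by simp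
  then have "\<not> induced_2K2 (contract G e) a b c d" for e a b c d
    using induced_2K2_of_contract[OF assms(1)] by blast
  then show "\<forall>e\<in>edges G. graph_free two_K2 (contract G e)"
    by (simp add: graph_free_two_K2_iff finite_simple_graph_contract assms(1))
next
  assume "\<forall>e\<in>edges G. graph_free two_K2 (contract G e)"
  then have free: "\<not> induced_2K2 (contract G e) a b c d" if "e \<in> edges G" for e a b c d
    using that by (simp add: graph_free_two_K2_iff finite_simple_graph_contract assms(1))
  show "graph_free two_K2 G"
  proof (rule ccontr)
    assume "\<not> graph_free two_K2 G"
    then obtain r s t u where base: "induced_2K2 G r s t u"
      by (auto simp: graph_free_two_K2_iff[OF assms(1)])
    interpret critical_2K2 G r s t u
    proof
      fix v show "\<not> isolated G v" using assms(2) by simp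
    next
      fix a b c d e
      assume "induced_2K2 G a b c d" "e \<in> edges G"
      then show "e \<inter> {a, b, c, d} \<noteq> {}" using contract_disjoint_edge free by metis
    next
      fix a b c d x
      assume ind: "induced_2K2 G a b c d" and x: "{x, a} \<in> edges G" "x \<noteq> b"
      \<comment> \<open>Otherwise \<open>xa\<close> would be one of the non-edges between the two
        edges of the \<open>2K_2\<close>.\<close>
      have "x \<noteq> c" "x \<noteq> d" using ind x(1) by (auto simp: induced_2K2_def insert_commute)
      then show "{x, c} \<in> edges G \<or> {x, d} \<in> edges G"
        using contract_pendant_edge[OF assms(1) ind x(2)] free[OF x(1)] by metis
    qed (fact assms(1) base)+
    show False using classification assms(3-8) by blast
  qed
qed

end
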